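(* For every positive integer $k$, let $[k]$ denote the generalized pattern $123\cdots k$ (no dashes). Then the generating function $F_{[k]}(x)$ satisfies $$F_{[k]}(x)=\sum_{j=0}^{k-1}\bigl(xF_{[k]}(x)\bigr)^j.$$
   Context: A generalized pattern is a permutation of $\{1,\dots,k\}$ written as a word $\tau_1\cdots\tau_k$ in which each pair of adjacent letters may or may not be separated by a dash "-". A permutation $\pi=\pi_1\cdots\pi_n\in S_n$ contains $\tau$ if there are indices $i_1<\dots<i_k$ with $(\pi_{i_1},\dots,\pi_{i_k})$ order-isomorphic to $(\tau_1,\dots,\tau_k)$ and $i_{j+1}=i_j+1$ whenever $\tau_j,\tau_{j+1}$ are not separated by a dash; otherwise $\pi$ avoids $\tau$. Thus $123\cdots k$ (no dashes) requires $k$ consecutive increasing entries, and $1\mbox{-}3\mbox{-}2$ is the classical pattern $132$. $F_\tau(x)=\sum_{n\geq0}f_\tau(n)x^n$, where $f_\tau(n)$ is the number of permutations in $S_n$ ($S_0$ = the empty permutation) avoiding both $1\mbox{-}3\mbox{-}2$ and $\tau$. *)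

theory Defs
  imports
    "HOL-Combinatorics.Multiset_Permutations"
    "HOL-Computational_Algebra.Formal_Power_Series"
begin

text \<open>
  A generalized pattern is a pair \<open>(\<tau>, D)\<close> of a word and the set of positions of its dashes:
  \<open>j \<in> D\<close> means that the letters \<open>\<tau> ! j\<close> and \<open>\<tau> ! Suc j\<close> (counting from 0) are
  separated by a dash.
\<close>

type_synonym gen_pattern = "nat list \<times> nat set"

definition is_gen_pattern :: "gen_pattern \<Rightarrow> bool" where
  "is_gen_pattern p \<longleftrightarrow>
     fst p \<in> permutations_of_set {1..length (fst p)} \<and>
     snd p \<subseteq> {j. Suc j < length (fst p)}"

definition contains_pattern :: "nat list \<Rightarrow> gen_pattern \<Rightarrow> bool" where
  "contains_pattern \<pi> p \<longleftrightarrow> (case p of (\<tau>, D) \<Rightarrow>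
     (\<exists>i :: nat \<Rightarrow> nat.
        strict_mono_on {..<length \<tau>} i \<and>
        (\<forall>j < length \<tau>. i j < length \<pi>) \<and>
        (\<forall>a < length \<tau>. \<forall>b < length \<tau>. \<pi> ! i a < \<pi> ! i b \<longleftrightarrow> \<tau> ! a < \<tau> ! b) \<and>
        (\<forall>j. Suc j < length \<tau> \<longrightarrow> j \<notin> D \<longrightarrow> i (Suc j) = Suc (i j))))"

definition avoids_pattern :: "nat list \<Rightarrow> gen_pattern \<Rightarrow> bool" where
  "avoids_pattern \<pi> p \<longleftrightarrow> \<not> contains_pattern \<pi> p"

definition pattern_1_3_2 :: gen_pattern where
  "pattern_1_3_2 = ([1, 3, 2], {0, 1})"

definition increasing_pattern :: "nat \<Rightarrow> gen_pattern" where
  "increasing_pattern k = ([1..<Suc k], {})"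

definition avoid_count :: "gen_pattern \<Rightarrow> nat \<Rightarrow> nat" where
  "avoid_count p n =
     card {\<pi> \<in> permutations_of_set {1..n}. avoids_pattern \<pi> pattern_1_3_2 \<and> avoids_pattern \<pi> p}"

definition avoid_gf :: "gen_pattern \<Rightarrow> int fps" where
  "avoid_gf p = Abs_fps (\<lambda>n. int (avoid_count p n))"

lemma is_gen_pattern_1_3_2: "is_gen_pattern pattern_1_3_2"
  by (auto simp: is_gen_pattern_def pattern_1_3_2_def permutations_of_set_def)

lemma is_gen_pattern_increasing: "is_gen_pattern (increasing_pattern k)"
  by (auto simp: is_gen_pattern_def increasing_pattern_def permutations_of_set_def)

end

theory Submission
  imports Defs
begin

text \<open>
  A nonempty permutation avoiding 1-3-2 is uniquely \<open>A n B\<close> with \<open>n\<close> its maximum, every letter of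
  \<open>A\<close> larger than every letter of \<open>B\<close>, and \<open>A\<close>, \<open>B\<close> avoiding 1-3-2.  Let \<open>F\<close> count the avoiders
  without \<open>k\<close> consecutive increasing letters and let \<open>H\<^sub>i\<close> count those among them whose last
  ascending run has length exactly \<open>i\<close>.  Since \<open>n\<close> prolongs the last run of \<open>A\<close> and \<open>B\<close> starts a
  new run, with \<open>S = x (H\<^sub>0 + \<dots> + H\<^bsub>k-2\<^esub>)\<close> one gets \<open>F = 1 + S F\<close> and
  \<open>H\<^sub>i = x H\<^bsub>i-1\<^esub> + S H\<^sub>i\<close> for \<open>0 < i < k\<close>.  Hence \<open>F (1 - S) = 1\<close>, so \<open>H\<^sub>i = x F H\<^bsub>i-1\<^esub>\<close>,
  so \<open>H\<^sub>i = (x F)\<^sup>i\<close>, and \<open>F = H\<^sub>0 + \<dots> + H\<^bsub>k-1\<^esub>\<close>.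
\<close>

section \<open>Patterns\<close>

definition has_132 :: "nat list \<Rightarrow> bool" where
  "has_132 xs \<longleftrightarrow>
     (\<exists>i j l. i < j \<and> j < l \<and> l < length xs \<and> xs ! i < xs ! l \<and> xs ! l < xs ! j)"

text \<open>Contiguity is expressed by a factor of the word, a form suited to concatenation
  arguments around the maximum.\<close>

definition has_run :: "nat \<Rightarrow> nat list \<Rightarrow> bool" where
  "has_run k xs \<longleftrightarrow> (\<exists>u v w. xs = u @ v @ w \<and> length v = k \<and> sorted_wrt (<) v)"

lemma contains_pattern_1_3_2_iff: "contains_pattern xs pattern_1_3_2 \<longleftrightarrow> has_132 xs"
proof
  assume "contains_pattern xs pattern_1_3_2"
  then obtain i :: "nat \<Rightarrow> nat" where i: "strict_mono_on {..<3} i" "\<forall>j<3. i j < length xs"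
    and o: "\<forall>a<3. \<forall>b<3. xs ! i a < xs ! i b \<longleftrightarrow> [1, 3, 2 :: nat] ! a < [1, 3, 2] ! b"
    by (auto simp: contains_pattern_def pattern_1_3_2_def numeral_3_eq_3)
  have "i 0 < i 1" "i 1 < i 2"
    using i(1) by (auto simp: strict_mono_on_def)
  moreover have "xs ! i 0 < xs ! i 2" "xs ! i 2 < xs ! i 1"
    using o by (auto simp: numeral_3_eq_3 numeral_2_eq_2)
  ultimately show "has_132 xs"
    using i(2) unfolding has_132_def by (metis lessI numeral_2_eq_2 numeral_3_eq_3)
next
  assume "has_132 xs"
  then obtain i j l where "i < j" "j < l" "l < length xs" "xs ! i < xs ! l" "xs ! l < xs ! j"
    by (auto simp: has_132_def)
  then show "contains_pattern xs pattern_1_3_2"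
    unfolding contains_pattern_def pattern_1_3_2_def
    by (auto intro!: exI[of _ "\<lambda>t. [i, j, l] ! t"] strict_mono_onI
        simp: less_Suc_eq numeral_2_eq_2)
qed

text \<open>Without dashes each index is the successor of the previous one, so the embedding is
  \<open>i j = i 0 + j\<close> and selects a window of \<open>k\<close> letters.\<close>

lemma contains_increasing_pattern_iff:
  assumes "k \<ge> 1"
  shows "contains_pattern xs (increasing_pattern k) \<longleftrightarrow> has_run k xs"
proof
  assume "contains_pattern xs (increasing_pattern k)"
  then obtain i :: "nat \<Rightarrow> nat" where i: "\<forall>j<k. i j < length xs"
    and o: "\<forall>a<k. \<forall>b<k. xs ! i a < xs ! i b \<longleftrightarrow> a < b"
    and c: "\<forall>j. Suc j < k \<longrightarrow> i (Suc j) = Suc (i j)"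
    by (auto simp: contains_pattern_def increasing_pattern_def simp del: upt_Suc)
  have ij: "i j = i 0 + j" if "j < k" for j
    using that by (induction j) (use c in auto)
  \<comment> \<open>The last index \<open>k - 1\<close>, which exists because
    \<open>k \<ge> 1\<close>, lies inside the word, so the whole window fits.\<close>
  have len: "i 0 + k \<le> length xs"
    using i[rule_format, of "k - 1"] ij[of "k - 1"] assms by auto
  let ?v = "take k (drop (i 0) xs)"
  have "?v ! a < ?v ! b" if "a < b" "b < k" for a b
    using o[rule_format, of a b] that ij[of a] ij[of b] len by simp
  then have "sorted_wrt (<) ?v"
    by (auto simp: sorted_wrt_iff_nth_less)
  moreover have "xs = take (i 0) xs @ ?v @ drop k (drop (i 0) xs)"
    by (metis append_take_drop_id)
  moreover have "length ?v = k"
    using len by simp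
  ultimately show "has_run k xs"
    unfolding has_run_def by blast
next
  assume "has_run k xs"
  then obtain u v w where x: "xs = u @ v @ w" "length v = k" and v: "sorted_wrt (<) v"
    by (auto simp: has_run_def)
  have "v ! a < v ! b \<longleftrightarrow> a < b" if "a < k" "b < k" for a b
    using that v x(2) by (metis linorder_neqE_nat order_less_asym sorted_wrt_nth_less)
  then show "contains_pattern xs (increasing_pattern k)"
    unfolding contains_pattern_def increasing_pattern_def
    using x by (auto intro!: exI[of _ "\<lambda>j. length u + j"] strict_mono_onI
        simp: nth_append simp del: upt_Suc)
qed

text \<open>The maximum \<open>m\<close> can only play the role of 3. An occurrence thus lies within
  \<open>A\<close>, within \<open>B\<close>, or has its 1 in \<open>A\<close> and its 2 in
  \<open>B\<close>; in the last case \<open>m\<close> itself can serve as the 3.\<close>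

lemma has_132_append_max:
  assumes "\<forall>a\<in>set A. a < m" and "\<forall>b\<in>set B. b < m"
  shows "has_132 (A @ m # B) \<longleftrightarrow>
    has_132 A \<or> has_132 B \<or> (\<exists>a\<in>set A. \<exists>b\<in>set B. a < b)" (is "?L \<longleftrightarrow> ?R")
proof
  let ?x = "A @ m # B"
  assume ?L
  then obtain i j l where ijl: "i < j" "j < l" "l < length ?x"
    and v: "?x ! i < ?x ! l" "?x ! l < ?x ! j"
    by (auto simp: has_132_def)
  have le: "?x ! t \<le> m" if "t < length ?x" for t
    using nth_mem[OF that] assms by auto
  have m: "?x ! length A = m"
    by simp
  \<comment> \<open>The letters at \<open>i\<close> and \<open>l\<close> are smaller than the one at
    \<open>j\<close>, hence smaller than \<open>m\<close>.\<close>
  have "i \<noteq> length A" "l \<noteq> length A"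
    using v m le[of j] le[of l] ijl by auto
  then consider "l < length A" | "i > length A" | "i < length A" "l > length A"
    by linarith
  then show ?R
  proof cases
    case 1
    then have "has_132 A"
      using ijl v unfolding has_132_def
      by (intro exI[of _ i] exI[of _ j] exI[of _ l]) (auto simp: nth_append)
    then show ?thesis by simp
  next
    case 2
    define s where "s = Suc (length A)"
    have B: "?x ! t = B ! (t - s)" if "t \<ge> s" for t
      using that by (auto simp: s_def nth_append nth_Cons' )
    have "has_132 B"
      using ijl v 2 B[of i] B[of j] B[of l] unfolding has_132_def
      by (intro exI[of _ "i - s"] exI[of _ "j - s"] exI[of _ "l - s"]) (auto simp: s_def)
    then show ?thesis by simp
  next
    case 3
    then have "?x ! i \<in> set A" "?x ! l \<in> set B"
      using ijl by (auto simp: nth_append nth_Cons')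
    then show ?thesis using v by blast
  qed
next
  assume ?R
  then consider "has_132 A" | "has_132 B" | a b where "a \<in> set A" "b \<in> set B" "a < b"
    by blast
  then show ?L
  proof cases
    case 1
    then obtain i j l where "i < j" "j < l" "l < length A" "A ! i < A ! l" "A ! l < A ! j"
      by (auto simp: has_132_def)
    then show ?thesis unfolding has_132_def
      by (intro exI[of _ i] exI[of _ j] exI[of _ l]) (auto simp: nth_append)
  next
    case 2
    then obtain i j l where "i < j" "j < l" "l < length B" "B ! i < B ! l" "B ! l < B ! j"
      by (auto simp: has_132_def)
    then show ?thesis unfolding has_132_def
      by (intro exI[of _ "Suc (length A) + i"] exI[of _ "Suc (length A) + j"]
          exI[of _ "Suc (length A) + l"]) (auto simp: nth_append)
  next
    case 3
    then obtain i l where "i < length A" "A ! i = a" "l < length B" "B ! l = b"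
      by (metis in_set_conv_nth)
    then show ?thesis unfolding has_132_def using 3 assms
      by (intro exI[of _ i] exI[of _ "length A"] exI[of _ "Suc (length A) + l"])
        (auto simp: nth_append)
  qed
qed

text \<open>Occurrences depend only on relative order. This lets the upper part of a split avoider
  be moved down to an initial interval and back.\<close>

lemma has_132_map_shift: "has_132 (map (\<lambda>x. x + c) xs) \<longleftrightarrow> has_132 xs"
proof -
  have "i < j \<and> j < l \<and> l < length xs \<and> map (\<lambda>x. x + c) xs ! i < map (\<lambda>x. x + c) xs ! l \<and>
        map (\<lambda>x. x + c) xs ! l < map (\<lambda>x. x + c) xs ! j \<longleftrightarrow>
      i < j \<and> j < l \<and> l < length xs \<and> xs ! i < xs ! l \<and> xs ! l < xs ! j" for i j l
    by auto
  then show ?thesis by (simp add: has_132_def)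
qed

lemma has_run_map_shift: "has_run k (map (\<lambda>x. x + c) xs) \<longleftrightarrow> has_run k xs"
proof
  assume "has_run k xs"
  then obtain u v w where "xs = u @ v @ w" "length v = k" "sorted_wrt (<) v"
    by (auto simp: has_run_def)
  then show "has_run k (map (\<lambda>x. x + c) xs)"
    unfolding has_run_def
    by (intro exI[of _ "map (\<lambda>x. x + c) u"] exI[of _ "map (\<lambda>x. x + c) v"]
        exI[of _ "map (\<lambda>x. x + c) w"]) (auto simp: sorted_wrt_map)
next
  assume "has_run k (map (\<lambda>x. x + c) xs)"
  then obtain u v w where e: "map (\<lambda>x. x + c) xs = u @ v @ w" "length v = k" "sorted_wrt (<) v"
    by (auto simp: has_run_def)
  \<comment> \<open>A factorization of the shifted word pulls back to one of the original
    word.\<close>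
  from e(1) obtain u' t where "xs = u' @ t" "v @ w = map (\<lambda>x. x + c) t"
    unfolding map_eq_append_conv by metis
  moreover from this(2) obtain v' w' where "t = v' @ w'" "v = map (\<lambda>x. x + c) v'"
    unfolding append_eq_map_conv by metis
  ultimately have "xs = u' @ v' @ w'" "v = map (\<lambda>x. x + c) v'"
    by simp_all
  then show "has_run k xs"
    using e unfolding has_run_def
    by (intro exI[of _ u'] exI[of _ v'] exI[of _ w']) (simp add: sorted_wrt_map)
qed

section \<open>The last ascending run\<close>

text \<open>Length of the longest strictly decreasing prefix. Reversal turns the last ascending run
  into such a prefix, where recursion at the head can reach it.\<close>

fun first_desc_run :: "nat list \<Rightarrow> nat" where
  "first_desc_run [] = 0"
| "first_desc_run [x] = 1"
| "first_desc_run (x # y # zs) = (if x > y then Suc (first_desc_run (y # zs)) else 1)"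

definition last_run :: "nat list \<Rightarrow> nat" where
  "last_run xs = first_desc_run (rev xs)"

text \<open>Shortening a decreasing prefix keeps it decreasing, so the lengths of such prefixes form
  an initial segment. The bound by \<open>length xs\<close> guards against \<open>take\<close>
  returning fewer than \<open>j\<close> letters.\<close>

lemma le_first_desc_run_iff:
  "j \<le> first_desc_run xs \<longleftrightarrow> j \<le> length xs \<and> sorted_wrt (>) (take j xs)"
proof (induction xs arbitrary: j rule: first_desc_run.induct)
  case (2 x)
  then show ?case by (cases j) auto
next
  case (3 x y zs)
  have tr: "\<forall>z\<in>set (take t zs). z < x"
    if "y < x" "\<forall>z\<in>set (take t zs). z < y" for t
    using that by force
  show ?case
  proof (cases j)
    case (Suc i)
    show ?thesis
    proof (cases "x > y")
      case True
      then show ?thesis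
        using 3[OF True, of i] Suc tr by (cases i) auto
    next
      case False
      then show ?thesis using Suc by (cases i) auto
    qed
  qed simp
qed simp

lemma le_last_run_iff:
  "j \<le> last_run xs \<longleftrightarrow> (\<exists>u v. xs = u @ v \<and> length v = j \<and> sorted_wrt (<) v)" (is "_ \<longleftrightarrow> ?R")
proof -
  \<comment> \<open>The length of \<open>v\<close> determines the cut, so the existential has only
    one candidate.\<close>
  have "?R \<longleftrightarrow> j \<le> length xs \<and> sorted_wrt (<) (drop (length xs - j) xs)"
    by (metis append_take_drop_id diff_diff_cancel diff_is_0_eq diff_le_self le_add2
        length_append length_drop append_eq_conv_conj add_diff_cancel_right')
  moreover have "sorted_wrt (>) (take j (rev xs)) \<longleftrightarrow> sorted_wrt (<) (drop (length xs - j) xs)"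
    by (simp add: take_rev sorted_wrt_rev)
  ultimately show ?thesis
    by (simp add: last_run_def le_first_desc_run_iff)
qed

text \<open>Even a single letter is an ascending run. Hence the class of value 0 contains only the
  empty word, the base case \<open>H\<^sub>0 = 1\<close>.\<close>

lemma last_run_eq_0_iff: "last_run xs = 0 \<longleftrightarrow> xs = []"
  unfolding last_run_def by (cases "rev xs" rule: first_desc_run.cases) auto

lemma last_run_map_shift: "last_run (map (\<lambda>x. x + c) xs) = last_run xs"
proof -
  have "first_desc_run (map (\<lambda>x. x + c) ys) = first_desc_run ys" for ys
    by (induction ys rule: first_desc_run.induct) auto
  then show ?thesis by (simp add: last_run_def rev_map)
qed

lemma last_run_snoc_max:
  assumes "\<forall>a\<in>set A. a < m"
  shows "last_run (A @ [m]) = Suc (last_run A)"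
proof (cases "rev A")
  case (Cons a as)
  then have "a \<in> set A" by (metis list.set_intros(1) set_rev)
  then show ?thesis using assms Cons by (simp add: last_run_def)
qed (simp add: last_run_def)

lemma last_run_append_max:
  assumes "\<forall>b\<in>set B. b < m" and "B \<noteq> []"
  shows "last_run (A @ m # B) = last_run B"
proof -
  have "first_desc_run (ys @ m # zs) = first_desc_run ys" if "ys \<noteq> []" "last ys < m" for ys zs
    using that by (induction ys rule: first_desc_run.induct) auto
  from this[of "rev B" "rev A"] assms show ?thesis
    by (auto simp: last_run_def last_rev)
qed

lemma last_run_less_if_no_run: "\<not> has_run k xs \<Longrightarrow> last_run xs < k"
  unfolding has_run_def linorder_not_le[symmetric] le_last_run_iff by force

text \<open>An increasing factor through \<open>m\<close> must stop at \<open>m\<close>, as every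
  later letter is smaller; it therefore consists of the last \<open>k - 1\<close> letters of
  \<open>A\<close> followed by \<open>m\<close>.\<close>

lemma has_run_append_max:
  assumes "k \<ge> 1" and "\<forall>a\<in>set A. a < m" and "\<forall>b\<in>set B. b < m"
  shows "has_run k (A @ m # B) \<longleftrightarrow> has_run k A \<or> has_run k B \<or> k - 1 \<le> last_run A"
    (is "?L \<longleftrightarrow> ?R")
proof
  assume ?L
  then obtain u v w where uvw: "A @ m # B = u @ v @ w" "length v = k" "sorted_wrt (<) v"
    by (auto simp: has_run_def)
  then consider t where "u = A @ m # t" "B = t @ v @ w"
    | t where "A = u @ t" "t @ m # B = v @ w"
    unfolding append_eq_append_conv2 Cons_eq_append_conv by fastforce
  then show ?R
  proof cases
    case 1
    then show ?thesis using uvw has_run_def by blast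
  next
    case 2
    then consider s where "t = v @ s"
      | s where "v = t @ m # s" "B = s @ w"
      unfolding append_eq_append_conv2 Cons_eq_append_conv by fastforce
    then show ?thesis
    proof cases
      case 1
      then show ?thesis using 2 uvw has_run_def by blast
    next
      case s: 2
      \<comment> \<open>A letter of \<open>v\<close> after \<open>m\<close> would have to exceed
        \<open>m\<close>.\<close>
      have "s = []"
        using uvw(3) s assms(3) by (cases s) (auto simp: sorted_wrt_append)
      then have "length t = k - 1" "sorted_wrt (<) t"
        using uvw s by (auto simp: sorted_wrt_append)
      then show ?thesis using 2 le_last_run_iff by blast
    qed
  qed
next
  assume ?R
  then consider "has_run k A" | "has_run k B" | "k - 1 \<le> last_run A" by blast
  then show ?L
  proof cases
    case 1
    then show ?thesis unfolding has_run_def by (metis append.assoc)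
  next
    case 2
    then show ?thesis unfolding has_run_def by (metis append.assoc append_Cons)
  next
    case 3
    then obtain u v where uv: "A = u @ v" "length v = k - 1" "sorted_wrt (<) v"
      unfolding le_last_run_iff by blast
    then have "A @ m # B = u @ (v @ [m]) @ B" "length (v @ [m]) = k" "sorted_wrt (<) (v @ [m])"
      using assms by (auto simp: sorted_wrt_append)
    then show ?thesis unfolding has_run_def by blast
  qed
qed

section \<open>Splitting a 1-3-2 avoider at its maximum\<close>

definition avoiders :: "nat \<Rightarrow> nat list set" where
  "avoiders n = {\<pi> \<in> permutations_of_set {1..n}. \<not> has_132 \<pi>}"

text \<open>For avoiders \<open>A\<close> and \<open>B\<close>, each on its own initial interval,
  raising \<open>A\<close> by \<open>length B\<close> places it above \<open>B\<close>, and the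
  letter in between is the new maximum.\<close>

definition glue :: "nat list \<Rightarrow> nat list \<Rightarrow> nat list" where
  "glue A B = map (\<lambda>x. x + length B) A @ Suc (length A + length B) # B"

lemma finite_avoiders: "finite (avoiders n)"
  by (simp add: avoiders_def)

lemma avoidersD:
  assumes "xs \<in> avoiders n"
  shows "length xs = n" "set xs = {1..n}" "distinct xs" "\<not> has_132 xs"
  using assms by (auto simp: avoiders_def permutations_of_set_def dest: distinct_card)

lemma avoiders_0: "avoiders 0 = {[]}"
  by (auto simp: avoiders_def has_132_def)

lemma image_add_interval: "(\<lambda>x. x + c) ` {1..n} = {Suc c..n + c}" for c n :: nat
  using image_add_atLeastAtMost[of c 1 n] by (simp add: add.commute)

lemma glue_in_avoiders:
  assumes "A \<in> avoiders m" "B \<in> avoiders r"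
  shows "glue A B \<in> avoiders (Suc (m + r))"
proof -
  note A = avoidersD[OF assms(1)] and B = avoidersD[OF assms(2)]
  have s: "set (map (\<lambda>x. x + length B) A) = {Suc r..m + r}"
    unfolding set_map A(2) B(1) by (rule image_add_interval)
  have "\<not> has_132 (glue A B)"
    unfolding glue_def
    by (subst has_132_append_max) (use s A B in \<open>auto simp: has_132_map_shift\<close>)
  moreover have "set (glue A B) = {1..Suc (m + r)}"
    unfolding glue_def using s A B by auto
  moreover have "distinct (glue A B)"
    unfolding glue_def using s A B by (auto simp: distinct_map)
  ultimately show ?thesis
    by (auto simp: avoiders_def permutations_of_set_def)
qed

text \<open>A number up to \<open>Max T\<close> cannot belong to \<open>S\<close>, whose elements
  all exceed \<open>Max T\<close>; so \<open>T\<close> has no gaps below its maximum.\<close>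

lemma lower_part_of_interval:
  fixes S T :: "nat set"
  assumes "S \<union> T = {1..n}" and "\<And>s t. s \<in> S \<Longrightarrow> t \<in> T \<Longrightarrow> t < s"
  shows "T = {1..card T}"
proof (cases "T = {}")
  case False
  have fin: "finite T"
    using assms(1) by (metis finite_Un finite_atLeastAtMost)
  have "T = {1..Max T}"
  proof (intro equalityI subsetI)
    fix x assume "x \<in> {1..Max T}"
    moreover have "Max T \<in> T" using fin False by simp
    moreover have "Max T \<in> {1..n}" using \<open>Max T \<in> T\<close> assms(1) by blast
    ultimately have "x \<in> S \<union> T" "\<not> Max T < x"
      unfolding assms(1) by auto
    then show "x \<in> T" using assms(2) \<open>Max T \<in> T\<close> by blast
  qed (use assms(1) fin in auto)
  then show ?thesis by (metis card_atLeastAtMost diff_Suc_1)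
qed simp

lemma avoiders_Suc_split:
  assumes "xs \<in> avoiders (Suc n)"
  obtains m A B where "m \<le> n" "A \<in> avoiders m" "B \<in> avoiders (n - m)" "xs = glue A B"
proof -
  note x = avoidersD[OF assms]
  have "Suc n \<in> set xs" using x by simp
  then obtain C B where xs: "xs = C @ Suc n # B"
    by (auto simp: in_set_conv_decomp)
  have un: "set C \<union> set B = {1..n}"
  proof -
    have "set C \<union> set B = set xs - {Suc n}"
      using x(3) xs by auto
    then show ?thesis using x(2) by auto
  qed
  then have lt: "\<forall>a\<in>set C. a < Suc n" "\<forall>b\<in>set B. b < Suc n"
    by (auto simp: less_Suc_eq_le)
  \<comment> \<open>Avoidance excludes a smaller letter before the maximum and a larger one after
    it, which forces \<open>C\<close> above \<open>B\<close>.\<close>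
  have av: "\<not> has_132 C" "\<not> has_132 B" and cb: "\<forall>a\<in>set C. \<forall>b\<in>set B. \<not> a < b"
    using x(4) has_132_append_max[OF lt] xs by auto
  have dis: "distinct C" "distinct B" "set C \<inter> set B = {}"
    using x(3) xs by auto
  define r where "r = length B"
  have cbl: "b < a" if "a \<in> set C" "b \<in> set B" for a b
    using cb that dis(3) by (metis IntI empty_iff linorder_neqE_nat)
  have sB: "set B = {1..r}"
    using lower_part_of_interval[OF un cbl] dis distinct_card[of B] by (simp add: r_def)
  have sC: "set C = {Suc r..n}"
  proof -
    have "set C = {1..n} - {1..r}" using un sB dis(3) by auto
    also have "\<dots> = {Suc r..n}" by auto
    finally show ?thesis .
  qed
  have len: "length C + r = n"
    using x(1) xs by (simp add: r_def)
  \<comment> \<open>Every letter of \<open>C\<close> exceeds \<open>r\<close>, so the truncated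
    subtraction loses nothing and adding \<open>r\<close> restores \<open>C\<close>.\<close>
  define A where "A = map (\<lambda>x. x - r) C"
  have CA: "C = map (\<lambda>x. x + r) A"
    unfolding A_def map_map o_def using sC by (intro map_idI[symmetric]) auto
  have "(\<lambda>x. x + r) ` set A = (\<lambda>x. x + r) ` {1..length C}"
    using sC CA len by (metis image_add_interval set_map)
  then have "set A = {1..length C}"
    by (subst (asm) inj_image_eq_iff) (auto simp: inj_def)
  moreover have "distinct A"
    using dis(1) CA by (simp add: distinct_map)
  moreover have "\<not> has_132 A"
    using av(1) CA has_132_map_shift by metis
  ultimately have "A \<in> avoiders (length C)"
    by (auto simp: avoiders_def permutations_of_set_def)
  moreover have "B \<in> avoiders (n - length C)"
    using sB dis av len by (auto simp: avoiders_def permutations_of_set_def)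
  moreover have "xs = glue A B"
  proof -
    have "length A = length C" by (simp add: A_def)
    then show ?thesis using xs len by (simp add: glue_def CA[symmetric] flip: r_def)
  qed
  ultimately show thesis
    using that[of "length C"] len by simp
qed

text \<open>The maximum occurs once and so marks the cut. Then \<open>B = B'\<close> gives equal
  shifts, and the shift is injective.\<close>

lemma glue_inject:
  assumes "A \<in> avoiders m" "B \<in> avoiders r" "A' \<in> avoiders m'" "B' \<in> avoiders r'"
    and eq: "glue A B = glue A' B'"
  shows "A = A' \<and> B = B'"
proof -
  note A = avoidersD[OF assms(1)] and B = avoidersD[OF assms(2)]
  note A' = avoidersD[OF assms(3)] and B' = avoidersD[OF assms(4)]
  have "length (glue A B) = length (glue A' B')" using eq by simp
  then have len: "m + r = m' + r'" using A B A' B' by (simp add: glue_def)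
  let ?A = "map (\<lambda>x. x + r) A" and ?A' = "map (\<lambda>x. x + r') A'" and ?m = "Suc (m + r)"
  have g: "?A @ ?m # B = ?A' @ ?m # B'"
    using eq A B A' B' len by (simp add: glue_def)
  have "?m \<notin> set ?A" "?m \<notin> set B" using A B by auto
  with g have 1: "?A = ?A'" "B = B'"
    by (auto simp: append_Cons_eq_iff)
  then have "r = r'" using B B' by simp
  then have "A = A'" using 1(1) by (auto dest: map_injective simp: inj_def)
  with 1 show ?thesis by simp
qed

text \<open>Gluing is a bijection from pairs of avoiders of total size \<open>n\<close>. If
  \<open>Q\<close> separates into conditions on the two parts, the count is a convolution.\<close>

lemma card_avoiders_Suc:
  assumes "\<And>m r A B. A \<in> avoiders m \<Longrightarrow> B \<in> avoiders r \<Longrightarrow> Q (glue A B) \<longleftrightarrow> Q1 A \<and> Q2 B"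
  shows "card {xs \<in> avoiders (Suc n). Q xs} =
    (\<Sum>m=0..n. card {A \<in> avoiders m. Q1 A} * card {B \<in> avoiders (n - m). Q2 B})"
proof -
  define P where
    "P m = {A \<in> avoiders m. Q1 A} \<times> {B \<in> avoiders (n - m). Q2 B}" for m
  have inj: "inj_on (\<lambda>(A, B). glue A B) (\<Union>m\<in>{0..n}. P m)"
  proof (rule inj_onI, clarify)
    fix A B A' B' m m'
    assume "(A, B) \<in> P m" "(A', B') \<in> P m'" and eq: "glue A B = glue A' B'"
    then show "A = A' \<and> B = B'"
      by (intro glue_inject[OF _ _ _ _ eq]) (auto simp: P_def)
  qed
  have "{xs \<in> avoiders (Suc n). Q xs} = (\<lambda>(A, B). glue A B) ` (\<Union>m\<in>{0..n}. P m)"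
  proof (intro equalityI subsetI)
    fix xs assume "xs \<in> {xs \<in> avoiders (Suc n). Q xs}"
    then obtain m A B where "m \<le> n" "A \<in> avoiders m" "B \<in> avoiders (n - m)" "xs = glue A B" "Q xs"
      by (auto elim: avoiders_Suc_split)
    then have "(A, B) \<in> (\<Union>m\<in>{0..n}. P m)"
      using assms unfolding P_def by auto
    then show "xs \<in> (\<lambda>(A, B). glue A B) ` (\<Union>m\<in>{0..n}. P m)"
      using \<open>xs = glue A B\<close> by force
  next
    fix xs assume "xs \<in> (\<lambda>(A, B). glue A B) ` (\<Union>m\<in>{0..n}. P m)"
    then obtain m A B where AB: "m \<le> n" "A \<in> avoiders m" "Q1 A" "B \<in> avoiders (n - m)" "Q2 B"
      "xs = glue A B"
      unfolding P_def by auto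
    then show "xs \<in> {xs \<in> avoiders (Suc n). Q xs}"
      using assms glue_in_avoiders[of A m B "n - m"] by auto
  qed
  then have "card {xs \<in> avoiders (Suc n). Q xs} = card (\<Union>m\<in>{0..n}. P m)"
    using card_image[OF inj] by simp
  also have "\<dots> = (\<Sum>m=0..n. card (P m))"
  proof (rule card_UN_disjoint)
    \<comment> \<open>The length of the first component recovers the index.\<close>
    show "\<forall>i\<in>{0..n}. \<forall>j\<in>{0..n}. i \<noteq> j \<longrightarrow> P i \<inter> P j = {}"
      unfolding P_def using avoidersD(1) by blast
  qed (auto simp: P_def finite_avoiders)
  finally show ?thesis
    by (simp add: P_def card_cartesian_product)
qed

section \<open>Generating functions\<close>

definition gf :: "(nat list \<Rightarrow> bool) \<Rightarrow> int fps" where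
  "gf Q = Abs_fps (\<lambda>n. int (card {xs \<in> avoiders n. Q xs}))"

text \<open>The convolution is a Cauchy product, \<open>fps_X\<close> accounts for the maximum, and
  the empty word supplies the constant term.\<close>

lemma gf_glue:
  assumes "\<And>m r A B. A \<in> avoiders m \<Longrightarrow> B \<in> avoiders r \<Longrightarrow> Q (glue A B) \<longleftrightarrow> Q1 A \<and> Q2 B"
  shows "gf Q = (if Q [] then 1 else 0) + fps_X * (gf Q1 * gf Q2)"
proof (rule fps_ext)
  fix n
  show "fps_nth (gf Q) n = fps_nth ((if Q [] then 1 else 0) + fps_X * (gf Q1 * gf Q2)) n"
  proof (cases n)
    case 0
    have "{xs. xs = [] \<and> Q xs} = (if Q [] then {[]} else {})" by auto
    then show ?thesis
      using 0 by (simp add: gf_def avoiders_0)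
  next
    case (Suc r)
    have "fps_nth (gf Q) (Suc r) = fps_nth (gf Q1 * gf Q2) r"
      by (simp add: gf_def fps_mult_nth card_avoiders_Suc[of Q Q1 Q2, OF assms])
    then show ?thesis using Suc by simp
  qed
qed

lemma gf_cong: "(\<And>n xs. xs \<in> avoiders n \<Longrightarrow> Q xs \<longleftrightarrow> Q' xs) \<Longrightarrow> gf Q = gf Q'"
  unfolding gf_def by (simp cong: conj_cong)

lemma gf_disj:
  assumes "\<And>xs. \<not> (Q xs \<and> Q' xs)"
  shows "gf (\<lambda>xs. Q xs \<or> Q' xs) = gf Q + gf Q'"
proof (rule fps_ext)
  fix n
  have "{xs \<in> avoiders n. Q xs \<or> Q' xs} = {xs \<in> avoiders n. Q xs} \<union> {xs \<in> avoiders n. Q' xs}"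
    by auto
  moreover have "{xs \<in> avoiders n. Q xs} \<inter> {xs \<in> avoiders n. Q' xs} = {}"
    using assms by auto
  ultimately show "fps_nth (gf (\<lambda>xs. Q xs \<or> Q' xs)) n = fps_nth (gf Q + gf Q') n"
    by (simp add: gf_def card_Un_disjoint finite_avoiders)
qed

lemma gf_sum_statistic:
  fixes f :: "nat list \<Rightarrow> nat"
  shows "gf (\<lambda>xs. Q xs \<and> f xs < k) = (\<Sum>i<k. gf (\<lambda>xs. Q xs \<and> f xs = i))"
proof (induction k)
  case 0
  then show ?case by (simp add: gf_def fps_eq_iff)
next
  case (Suc k)
  have "gf (\<lambda>xs. Q xs \<and> f xs < Suc k) = gf (\<lambda>xs. (Q xs \<and> f xs < k) \<or> (Q xs \<and> f xs = k))"
    by (rule gf_cong) auto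
  also have "\<dots> = gf (\<lambda>xs. Q xs \<and> f xs < k) + gf (\<lambda>xs. Q xs \<and> f xs = k)"
    by (rule gf_disj) auto
  finally show ?case using Suc by simp
qed

lemma gf_Nil: "gf (\<lambda>xs. xs = []) = 1"
proof (rule fps_ext)
  fix n
  have "{xs \<in> avoiders n. xs = []} = (if n = 0 then {[]} else {})"
    using avoidersD(1)[of "[]" n] by (auto simp: avoiders_0)
  then show "fps_nth (gf (\<lambda>xs. xs = [])) n = fps_nth 1 n"
    by (simp add: gf_def)
qed

lemma avoid_gf_increasing_pattern:
  assumes "k \<ge> 1"
  shows "avoid_gf (increasing_pattern k) = gf (\<lambda>xs. \<not> has_run k xs)"
  unfolding avoid_gf_def avoid_count_def avoids_pattern_def gf_def avoiders_def
    contains_pattern_1_3_2_iff contains_increasing_pattern_iff[OF assms]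
  by (simp add: conj_assoc)

section \<open>Runs of a glued word and the resulting recursion\<close>

lemma glue_bounds:
  assumes "A \<in> avoiders m" "B \<in> avoiders r"
  shows "\<forall>a\<in>set (map (\<lambda>x. x + length B) A). a < Suc (length A + length B)"
    and "\<forall>b\<in>set B. b < Suc (length A + length B)"
  using avoidersD[OF assms(1)] avoidersD[OF assms(2)] by auto

text \<open>Negated, the right side separates into a condition on \<open>A\<close> and one on
  \<open>B\<close>, the shape that \<open>gf_glue\<close> requires.\<close>

lemma has_run_glue:
  assumes "k \<ge> 1" "A \<in> avoiders m" "B \<in> avoiders r"
  shows "has_run k (glue A B) \<longleftrightarrow> has_run k A \<or> has_run k B \<or> k - 1 \<le> last_run A"
  unfolding glue_def using has_run_append_max[OF assms(1) glue_bounds[OF assms(2,3)]]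
  by (simp only: has_run_map_shift last_run_map_shift)

lemma last_run_glue:
  assumes "A \<in> avoiders m" "B \<in> avoiders r"
  shows "last_run (glue A B) = (if B = [] then Suc (last_run A) else last_run B)"
proof (cases "B = []")
  case True
  then show ?thesis
    using last_run_snoc_max[OF glue_bounds(1)[OF assms]]
    by (simp add: glue_def last_run_map_shift)
next
  case False
  then show ?thesis
    using last_run_append_max[OF glue_bounds(2)[OF assms]] by (simp add: glue_def)
qed

text \<open>Tests on the glued word itself whether the maximum comes last, so that the two cases of
  \<open>last_run_glue\<close> can be counted separately.\<close>

lemma last_glue_eq_length_iff:
  assumes "A \<in> avoiders m" "B \<in> avoiders r"
  shows "last (glue A B) = length (glue A B) \<longleftrightarrow> B = []"
proof (cases "B = []")
  case False
  then have "last B < Suc (length A + length B)"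
    using glue_bounds(2)[OF assms] by simp
  then show ?thesis using False by (simp add: glue_def)
qed (simp add: glue_def)

lemma gf_last_run:
  assumes "i < k"
  shows "gf (\<lambda>xs. \<not> has_run k xs \<and> last_run xs = i) = (fps_X * gf (\<lambda>xs. \<not> has_run k xs)) ^ i"
    (is "?H i = (fps_X * ?F) ^ i")
  using assms
proof (induction i)
  case 0
  have "\<not> has_run k []" using 0 by (auto simp: has_run_def)
  then have "?H 0 = gf (\<lambda>xs. xs = [])"
    by (intro gf_cong) (auto simp: last_run_eq_0_iff)
  then show ?case by (simp add: gf_Nil)
next
  case (Suc i)
  have k: "k \<ge> 1" using Suc by simp
  define T where "T = gf (\<lambda>xs. \<not> has_run k xs \<and> last_run xs < k - 1)"
  have "\<not> has_run k []" using k by (auto simp: has_run_def)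
  then have F: "?F = 1 + fps_X * (T * ?F)"
    unfolding T_def
    by (subst gf_glue[of _ "\<lambda>xs. \<not> has_run k xs \<and> last_run xs < k - 1" "\<lambda>xs. \<not> has_run k xs"])
      (auto simp: has_run_glue[OF k])
  \<comment> \<open>Keeps the empty word out of both classes below, whatever \<open>last []\<close>
    is.\<close>
  have last_run_Nil: "last_run [] = 0"
    by (simp add: last_run_eq_0_iff)
  let ?Q = "\<lambda>xs. \<not> has_run k xs \<and> last_run xs = Suc i"
  have "?H (Suc i) =
      gf (\<lambda>xs. (?Q xs \<and> last xs = length xs) \<or> (?Q xs \<and> last xs \<noteq> length xs))"
    by (rule gf_cong) auto
  also have "\<dots> = gf (\<lambda>xs. ?Q xs \<and> last xs = length xs) + gf (\<lambda>xs. ?Q xs \<and> last xs \<noteq> length xs)"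
    by (rule gf_disj) auto
  \<comment> \<open>For \<open>B = []\<close> the part \<open>A\<close> has last run
    \<open>i\<close>; the bound \<open>i < k - 1\<close> it also needs follows from
    \<open>Suc i < k\<close>.\<close>
  also have "gf (\<lambda>xs. ?Q xs \<and> last xs = length xs) = fps_X * (?H i * gf (\<lambda>xs. xs = []))"
    by (subst gf_glue[of _ "\<lambda>xs. \<not> has_run k xs \<and> last_run xs = i" "\<lambda>xs. xs = []"])
      (use Suc.prems \<open>\<not> has_run k []\<close> in
        \<open>auto simp: has_run_glue[OF k] last_run_glue last_glue_eq_length_iff last_run_Nil\<close>)
  \<comment> \<open>Here \<open>B\<close> carries the last run, and its positive length
    \<open>Suc i\<close> already makes \<open>B\<close> nonempty.\<close>
  also have "gf (\<lambda>xs. ?Q xs \<and> last xs \<noteq> length xs) = fps_X * (T * ?H (Suc i))"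
    unfolding T_def
    by (subst gf_glue[of _ "\<lambda>xs. \<not> has_run k xs \<and> last_run xs < k - 1" ?Q])
      (auto simp: has_run_glue[OF k] last_run_glue last_glue_eq_length_iff last_run_Nil
        split: if_splits)
  finally have H: "?H (Suc i) = fps_X * ?H i + fps_X * (T * ?H (Suc i))"
    by (simp add: gf_Nil)
  \<comment> \<open>Thus \<open>?F\<close> is the inverse of \<open>1 - fps_X * T\<close>;
    multiplying by it solves the recursion for \<open>?H (Suc i)\<close>.\<close>
  have "?F * (1 - fps_X * T) = 1"
    using F by (simp add: algebra_simps)
  then have "?H (Suc i) = ?F * (?H (Suc i) * (1 - fps_X * T))"
    by (simp add: mult.left_commute)
  also have "?H (Suc i) * (1 - fps_X * T) = fps_X * ?H i"
    using H by (simp add: algebra_simps)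
  finally show ?case
    using Suc by (simp add: mult_ac)
qed

theorem theorem2p5:
  fixes k :: nat
  assumes "k \<ge> 1"
  shows "avoid_gf (increasing_pattern k) =
         (\<Sum>j = 0..k - 1. (fps_X * avoid_gf (increasing_pattern k)) ^ j)"
proof -
  let ?F = "gf (\<lambda>xs. \<not> has_run k xs)"
  \<comment> \<open>The added bound holds automatically, since a last run of length at least
    \<open>k\<close> would contain a forbidden factor.\<close>
  have "?F = gf (\<lambda>xs. \<not> has_run k xs \<and> last_run xs < k)"
    using last_run_less_if_no_run by (intro gf_cong) auto
  also have "\<dots> = (\<Sum>i<k. gf (\<lambda>xs. \<not> has_run k xs \<and> last_run xs = i))"
    by (rule gf_sum_statistic)
  also have "\<dots> = (\<Sum>i<k. (fps_X * ?F) ^ i)"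
    by (intro sum.cong) (auto simp: gf_last_run)
  also have "{..<k} = {0..k - 1}"
    using assms by auto
  finally show ?thesis
    by (simp add: avoid_gf_increasing_pattern[OF assms])
qed

end
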